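(* Suppose $P\subset\mathbb{R}^d$ is a generic orthotope of dimension $d$ and $\Pi=\Pi_{I,\lambda}\subset\mathbb{R}^d$ is a generalized hyperplane. Then $P\cap\Pi$, regarded as a subset of $\Pi\cong\mathbb{R}^{d-|I|}$, is a generic orthotope (of dimension $d-|I|$).
   Context: **Floral vertices.** A series-parallel diagram (SPD) $\Delta$ with finite nonempty edge set $E$ is either a single edge, or a series connection $\Delta_1\wedge\Delta_2$, or a parallel connection $\Delta_1\vee\Delta_2$, of SPDs with disjoint nonempty edge sets whose union is $E$ (a read-once formula in $\wedge,\vee$). The single vertex is admitted as an SPD with no edges. A signed SPD is a pair $(\Delta,s)$ with $s:E\to\{\pm1\}$. Let $H_i=\{x\in\mathbb{R}^d: x_i\ge 0\}$. If $E=\{1,\dots,d\}$, the floral vertex in $\mathbb{R}^d$ determined by $(\Delta,s)$ is the set obtained by interpreting edge $i$ as $s_iH_i$, series connection as intersection and parallel connection as union. (For $d=0$, the floral vertex is the point $\mathbb{R}^0$.) **Orthogonal polytopes.** An axis-aligned box is a product $\prod_{i=1}^d[a_i,b_i]$, $a_i\le b_i$; it is pure $d$-dimensional if all $a_i<b_i$. A pure $d$-dimensional orthogonal polytope is a finite (possibly empty) union of pure $d$-dimensional boxes; in particular the empty set is allowed. For $s\in\{\pm1\}^d$ the orthant $\Omega_s$ is $\{x: s_ix_i\ge0\ \forall i\}$; a local orthotopal arrangement is a union of orthants. The tangent cone of $P$ at $v\in P$ is the local orthotopal arrangement $\alpha$ such that for some $\delta>0$, $P\cap(v+[-\delta,\delta]^d)=v+(\alpha\cap[-\delta,\delta]^d)$.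 A generalized hyperplane is a set $\Pi_{I,\lambda}=\{x\in\mathbb{R}^d:x_i=\lambda(i)\ \forall i\in I\}$ with $I\subset\{1,\dots,d\}$, $\lambda:I\to\mathbb{R}$; it is identified with $\mathbb{R}^{d-|I|}$ by forgetting the coordinates in $I$. The genericity region of $v\in P$ is the set of points of $P$ joined to $v$ by a path in $P$ along which every tangent cone is congruent (under signed coordinate permutations) to the one at $v$. Its degree is the smallest dimension of a generalized hyperplane containing it. A point is singular (a vertex of $P$) if its genericity region has degree $0$. **Generic orthotope.** A generic orthotope of dimension $d$ is a pure $d$-dimensional orthogonal polytope in $\mathbb{R}^d$ such that the tangent cone at every singular point is a floral vertex in $\mathbb{R}^d$ (on $d$ half-spaces). *)

theory Defs
  imports "HOL-Analysis.Analysis"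
begin

text \<open>
  For a finite index set A, the space \<open>\<real>\<^sup>A\<close> is the set of real functions on A, extended by
  \<open>undefined\<close> outside A; \<open>\<real>\<^sup>d\<close> is the case A = {1..d}. General index sets are used so
  that forgetting the coordinates in I leads from \<open>\<real>\<^sup>A\<close> to the space indexed by A - I,
  of dimension card A - card I, without renumbering.
  Topological notions refer to the product topology on functions, whose restriction to
  \<open>coord_space A\<close> is the Euclidean topology for finite A.
\<close>

definition coord_space :: "'i set \<Rightarrow> ('i \<Rightarrow> real) set" where
  "coord_space A = A \<rightarrow>\<^sub>E UNIV"

definition translate :: "'i set \<Rightarrow> ('i \<Rightarrow> real) \<Rightarrow> ('i \<Rightarrow> real) set \<Rightarrow> ('i \<Rightarrow> real) set" where
  "translate A v S = (\<lambda>x. \<lambda>i\<in>A. v i + x i) ` S"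

definition signs :: "'i set \<Rightarrow> ('i \<Rightarrow> real) set" where
  "signs A = A \<rightarrow> {-1, 1}"


subsection \<open>Series-parallel diagrams and floral vertices\<close>

datatype 'e spd =
    Vertex
  | Edge 'e
  | Series "'e spd" "'e spd"
  | Parallel "'e spd" "'e spd"

fun edges :: "'e spd \<Rightarrow> 'e set" where
  "edges Vertex = {}"
| "edges (Edge e) = {e}"
| "edges (Series D1 D2) = edges D1 \<union> edges D2"
| "edges (Parallel D1 D2) = edges D1 \<union> edges D2"

text \<open>Nonemptiness excludes \<open>Vertex\<close> as a proper part of a connection.\<close>

fun is_spd :: "'e spd \<Rightarrow> bool" where
  "is_spd Vertex = True"
| "is_spd (Edge e) = True"
| "is_spd (Series D1 D2) \<longleftrightarrow> is_spd D1 \<and> is_spd D2 \<and>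
     edges D1 \<noteq> {} \<and> edges D2 \<noteq> {} \<and> edges D1 \<inter> edges D2 = {}"
| "is_spd (Parallel D1 D2) \<longleftrightarrow> is_spd D1 \<and> is_spd D2 \<and>
     edges D1 \<noteq> {} \<and> edges D2 \<noteq> {} \<and> edges D1 \<inter> edges D2 = {}"

fun spd_set :: "'i set \<Rightarrow> ('i \<Rightarrow> real) \<Rightarrow> 'i spd \<Rightarrow> ('i \<Rightarrow> real) set" where
  "spd_set A s Vertex = coord_space A"
| "spd_set A s (Edge i) = {x \<in> coord_space A. 0 \<le> s i * x i}"
| "spd_set A s (Series D1 D2) = spd_set A s D1 \<inter> spd_set A s D2"
| "spd_set A s (Parallel D1 D2) = spd_set A s D1 \<union> spd_set A s D2"

definition floral_vertex :: "'i set \<Rightarrow> ('i \<Rightarrow> real) set \<Rightarrow> bool" where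
  "floral_vertex A F \<longleftrightarrow>
     (\<exists>D s. is_spd D \<and> edges D = A \<and> s \<in> signs A \<and> F = spd_set A s D)"


subsection \<open>Orthogonal polytopes and tangent cones\<close>

definition pure_box :: "'i set \<Rightarrow> ('i \<Rightarrow> real) set \<Rightarrow> bool" where
  "pure_box A B \<longleftrightarrow> (\<exists>a b. (\<forall>i\<in>A. a i < b i) \<and> B = (\<Pi>\<^sub>E i\<in>A. {a i..b i}))"

definition pure_orthogonal_polytope :: "'i set \<Rightarrow> ('i \<Rightarrow> real) set \<Rightarrow> bool" where
  "pure_orthogonal_polytope A P \<longleftrightarrow>
     (\<exists>\<B>. finite \<B> \<and> (\<forall>B\<in>\<B>. pure_box A B) \<and> P = \<Union>\<B>)"

definition orthant :: "'i set \<Rightarrow> ('i \<Rightarrow> real) \<Rightarrow> ('i \<Rightarrow> real) set" where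
  "orthant A s = {x \<in> coord_space A. \<forall>i\<in>A. 0 \<le> s i * x i}"

definition local_arrangement :: "'i set \<Rightarrow> ('i \<Rightarrow> real) set \<Rightarrow> bool" where
  "local_arrangement A \<alpha> \<longleftrightarrow> (\<exists>S \<subseteq> signs A. \<alpha> = (\<Union>s\<in>S. orthant A s))"

definition cube :: "'i set \<Rightarrow> real \<Rightarrow> ('i \<Rightarrow> real) set" where
  "cube A \<delta> = (\<Pi>\<^sub>E i\<in>A. {-\<delta>..\<delta>})"

definition is_tangent_cone ::
    "'i set \<Rightarrow> ('i \<Rightarrow> real) set \<Rightarrow> ('i \<Rightarrow> real) \<Rightarrow> ('i \<Rightarrow> real) set \<Rightarrow> bool" where
  "is_tangent_cone A P v \<alpha> \<longleftrightarrow> local_arrangement A \<alpha> \<and>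
     (\<exists>\<delta>>0. P \<inter> translate A v (cube A \<delta>) = translate A v (\<alpha> \<inter> cube A \<delta>))"

definition tangent_cone ::
    "'i set \<Rightarrow> ('i \<Rightarrow> real) set \<Rightarrow> ('i \<Rightarrow> real) \<Rightarrow> ('i \<Rightarrow> real) set" where
  "tangent_cone A P v = (THE \<alpha>. is_tangent_cone A P v \<alpha>)"

lemma local_arrangement_scale:
  assumes "local_arrangement A \<alpha>" "x \<in> coord_space A" "0 < (c::real)"
  shows "(\<lambda>i\<in>A. c * x i) \<in> \<alpha> \<longleftrightarrow> x \<in> \<alpha>"
proof -
  have "(0 \<le> s * (c * y)) = (0 \<le> s * y)" for s y :: real
    using assms(3) by (simp add: zero_le_mult_iff mult_le_0_iff)
  then show ?thesis
    using assms(1,2) by (auto simp: local_arrangement_def orthant_def coord_space_def)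
qed

lemma is_tangent_cone_mono:
  assumes fin: "finite A"
    and "is_tangent_cone A P v \<alpha>" "is_tangent_cone A P v \<beta>"
  shows "\<alpha> \<subseteq> \<beta>"
proof
  fix x assume x: "x \<in> \<alpha>"
  obtain d where a: "local_arrangement A \<alpha>" "d > 0"
    "P \<inter> translate A v (cube A d) = translate A v (\<alpha> \<inter> cube A d)"
    using assms(2) unfolding is_tangent_cone_def by blast
  obtain e where b: "local_arrangement A \<beta>" "e > 0"
    "P \<inter> translate A v (cube A e) = translate A v (\<beta> \<inter> cube A e)"
    using assms(3) unfolding is_tangent_cone_def by blast
  have xs: "x \<in> coord_space A"
    using x a(1) by (auto simp: local_arrangement_def orthant_def)
  define M where "M = 1 + (\<Sum>i\<in>A. \<bar>x i\<bar>)"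
  define m where "m = min d e"
  define c where "c = m / M"
  define y where "y = (\<lambda>i\<in>A. c * x i)"
  have M: "M > 0" unfolding M_def by (simp add: add_pos_nonneg sum_nonneg)
  have m: "m > 0" using a(2) b(2) by (simp add: m_def)
  have c: "c > 0" using M m by (simp add: c_def)
  have "\<bar>y i\<bar> \<le> m" if "i \<in> A" for i
  proof -
    have "\<bar>x i\<bar> \<le> M"
      using member_le_sum[of i A "\<lambda>i. \<bar>x i\<bar>"] that fin by (simp add: M_def)
    then have "c * \<bar>x i\<bar> \<le> c * M" using c by simp
    then show ?thesis using that c M m by (simp add: y_def abs_mult c_def)
  qed
  then have "y i \<le> d \<and> - d \<le> y i \<and> y i \<le> e \<and> - e \<le> y i" if "i \<in> A" for i
    using that unfolding m_def by (meson abs_le_iff min.boundedE minus_le_iff order_trans)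
  then have cube: "y \<in> cube A d" "y \<in> cube A e"
    by (auto simp: cube_def y_def)
  have "y \<in> \<alpha>" using local_arrangement_scale[OF a(1) xs c] x by (simp add: y_def)
  then have "(\<lambda>i\<in>A. v i + y i) \<in> P" using a(3) cube by (auto simp: translate_def)
  then have "(\<lambda>i\<in>A. v i + y i) \<in> translate A v (\<beta> \<inter> cube A e)"
    using b(3) cube by (auto simp: translate_def)
  then obtain z where z: "z \<in> \<beta>" "z \<in> cube A e"
    "(\<lambda>i\<in>A. v i + y i) = (\<lambda>i\<in>A. v i + z i)"
    by (auto simp: translate_def)
  have "y = z"
  proof
    fix i show "y i = z i"
      using fun_cong[OF z(3), of i] z(2) by (cases "i \<in> A") (auto simp: y_def cube_def)
  qed
  then show "x \<in> \<beta>" using local_arrangement_scale[OF b(1) xs c] z(1) by (simp add: y_def)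
qed

lemma tangent_cone_eq:
  assumes "finite A" "is_tangent_cone A P v \<alpha>"
  shows "tangent_cone A P v = \<alpha>"
  unfolding tangent_cone_def
  using assms is_tangent_cone_mono[OF assms(1)] by (intro the_equality) blast+

text \<open>Congruence under signed coordinate permutations.\<close>

definition congruent_cones ::
    "'i set \<Rightarrow> ('i \<Rightarrow> real) set \<Rightarrow> ('i \<Rightarrow> real) set \<Rightarrow> bool" where
  "congruent_cones A \<alpha> \<beta> \<longleftrightarrow>
     (\<exists>\<pi> s. bij_betw \<pi> A A \<and> s \<in> signs A \<and> \<beta> = (\<lambda>x. \<lambda>i\<in>A. s i * x (\<pi> i)) ` \<alpha>)"


subsection \<open>Generalized hyperplanes, degree, generic orthotopes\<close>

text \<open>
  \<open>gen_hyperplane A I l\<close> is meant for I contained in A; only the values of l on I matter.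
  Its dimension is card A - card I.
\<close>

definition gen_hyperplane :: "'i set \<Rightarrow> 'i set \<Rightarrow> ('i \<Rightarrow> real) \<Rightarrow> ('i \<Rightarrow> real) set" where
  "gen_hyperplane A I l = {x \<in> coord_space A. \<forall>i\<in>I. x i = l i}"

definition forget :: "'i set \<Rightarrow> 'i set \<Rightarrow> ('i \<Rightarrow> real) \<Rightarrow> ('i \<Rightarrow> real)" where
  "forget A I x = restrict x (A - I)"

definition genericity_region ::
    "'i set \<Rightarrow> ('i \<Rightarrow> real) set \<Rightarrow> ('i \<Rightarrow> real) \<Rightarrow> ('i \<Rightarrow> real) set" where
  "genericity_region A P v = {w \<in> P. \<exists>g. path g \<and> path_image g \<subseteq> P \<and>
     pathstart g = v \<and> pathfinish g = w \<and>
     (\<forall>t\<in>{0..1}. congruent_cones A (tangent_cone A P v) (tangent_cone A P (g t)))}"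

definition region_degree :: "'i set \<Rightarrow> ('i \<Rightarrow> real) set \<Rightarrow> ('i \<Rightarrow> real) \<Rightarrow> nat" where
  "region_degree A P v = (LEAST n. \<exists>I l. I \<subseteq> A \<and> n = card A - card I \<and>
     genericity_region A P v \<subseteq> gen_hyperplane A I l)"

definition singular :: "'i set \<Rightarrow> ('i \<Rightarrow> real) set \<Rightarrow> ('i \<Rightarrow> real) \<Rightarrow> bool" where
  "singular A P v \<longleftrightarrow> v \<in> P \<and> region_degree A P v = 0"

definition generic_orthotope :: "'i set \<Rightarrow> ('i \<Rightarrow> real) set \<Rightarrow> bool" where
  "generic_orthotope A P \<longleftrightarrow> pure_orthogonal_polytope A P \<and>
     (\<forall>v. singular A P v \<longrightarrow> floral_vertex A (tangent_cone A P v))"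

end

theory Submission
  imports Defs
begin

text \<open>
  Call a coordinate essential for a cone if membership depends on it. Near a point with tangent
  cone \<open>\<alpha>\<close>, the tangent cone at a displacement \<open>y\<close> arises from \<open>\<alpha>\<close> by freezing the signs of the
  nonzero coordinates of \<open>y\<close>; hence a point is singular iff all coordinates are essential for its
  tangent cone. Freezing some inputs of a read-once formula leaves a read-once formula or a
  constant. From a point with an inessential coordinate one can move along that coordinate, with
  constant tangent cone, until more coordinates become essential; so by induction every tangent
  cone of a generic orthotope is cut out by a read-once formula. Slicing by a generalized
  hyperplane through the point sets the edges in \<open>I\<close> to true, which again gives a read-once
  formula, and at a singular point of the slice every coordinate must occur in it.
\<close>

subsection \<open>Read-once formulas\<close>

text \<open>Boolean reading of a diagram. \<open>Vertex\<close> is true, as an empty conjunction, in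
  line with \<open>spd_set\<close> giving the whole space.\<close>

fun spd_eval :: "('e \<Rightarrow> bool) \<Rightarrow> 'e spd \<Rightarrow> bool" where
  "spd_eval f Vertex \<longleftrightarrow> True"
| "spd_eval f (Edge e) \<longleftrightarrow> f e"
| "spd_eval f (Series D1 D2) \<longleftrightarrow> spd_eval f D1 \<and> spd_eval f D2"
| "spd_eval f (Parallel D1 D2) \<longleftrightarrow> spd_eval f D1 \<or> spd_eval f D2"

lemma spd_set_eq_eval:
  "spd_set A s D = {x \<in> coord_space A. spd_eval (\<lambda>i. 0 \<le> s i * x i) D}"
  by (induction D) auto

lemma spd_eval_cong:
  "(\<And>e. e \<in> edges D \<Longrightarrow> f e = g e) \<Longrightarrow> spd_eval f D = spd_eval g D"
  by (induction D) auto

lemma spd_eval_True: "spd_eval (\<lambda>_. True) D"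
  by (induction D) auto

lemma is_spd_edges_empty: "is_spd D \<Longrightarrow> edges D = {} \<Longrightarrow> D = Vertex"
  by (cases D) auto

text \<open>Constants propagate upwards: a false input annihilates a series connection and drops out
  of a parallel one, a true input the other way round. \<open>Vertex\<close> expresses the constant
  true, but no diagram expresses the constant false, whence the first alternative.\<close>

lemma is_spd_freeze:
  assumes "is_spd D"
  shows "(\<forall>f. \<not> spd_eval (\<lambda>e. if e \<in> J then b e else f e) D) \<or>
    (\<exists>D'. is_spd D' \<and> edges D' \<subseteq> edges D - J \<and>
       (\<forall>f. spd_eval (\<lambda>e. if e \<in> J then b e else f e) D = spd_eval f D'))"
proof -
  define g where "g f = (\<lambda>e. if e \<in> J then b e else f e)" for f
  have "(\<forall>f. \<not> spd_eval (g f) D) \<or>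
    (\<exists>D'. is_spd D' \<and> edges D' \<subseteq> edges D - J \<and> (\<forall>f. spd_eval (g f) D = spd_eval f D'))"
    (is "?F D \<or> (\<exists>D'. ?R D D')")
    using assms
  proof (induction D)
    case Vertex
    have "?R Vertex Vertex" by simp
    then show ?case by blast
  next
    case (Edge e)
    consider "e \<in> J" "b e" | "e \<in> J" "\<not> b e" | "e \<notin> J" by blast
    then show ?case
    proof cases
      case 1
      then have "?R (Edge e) Vertex" by (simp add: g_def)
      then show ?thesis by blast
    next
      case 2
      then show ?thesis by (simp add: g_def)
    next
      case 3
      then have "?R (Edge e) (Edge e)" by (simp add: g_def)
      then show ?thesis by blast
    qed
  next
    case (Series D1 D2)
    show ?case
    proof (cases "?F D1 \<or> ?F D2")
      case True
      then show ?thesis by auto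
    next
      case False
      then obtain E1 E2 where E: "?R D1 E1" "?R D2 E2"
        using Series by auto
      have disj: "edges E1 \<inter> edges E2 = {}"
        using E Series.prems by auto
      \<comment> \<open>\<open>Vertex\<close> may not be a proper part of a connection, so a factor
        that became constantly true is dropped.\<close>
      consider "E1 = Vertex" | "E2 = Vertex" | "edges E1 \<noteq> {}" "edges E2 \<noteq> {}"
        using E is_spd_edges_empty by blast
      then show ?thesis
      proof cases
        case 1
        then have "?R (Series D1 D2) E2" using E by auto
        then show ?thesis by blast
      next
        case 2
        then have "?R (Series D1 D2) E1" using E by auto
        then show ?thesis by blast
      next
        case 3
        then have "?R (Series D1 D2) (Series E1 E2)" using E disj by auto
        then show ?thesis by blast
      qed
    qed
  next
    case (Parallel D1 D2)
    consider "?F D1" "?F D2" | E2 where "?F D1" "?R D2 E2" | E1 where "?R D1 E1" "?F D2"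
      | E1 E2 where "?R D1 E1" "?R D2 E2"
      using Parallel by auto
    then show ?case
    proof cases
      case 1
      then show ?thesis by auto
    next
      case 2
      then have "?R (Parallel D1 D2) E2" by auto
      then show ?thesis by blast
    next
      case 3
      then have "?R (Parallel D1 D2) E1" by auto
      then show ?thesis by blast
    next
      case E: 4
      have disj: "edges E1 \<inter> edges E2 = {}"
        using E Parallel.prems by auto
      consider "E1 = Vertex \<or> E2 = Vertex" | "edges E1 \<noteq> {}" "edges E2 \<noteq> {}"
        using E is_spd_edges_empty by blast
      then show ?thesis
      proof cases
        case 1
        then have "?R (Parallel D1 D2) Vertex" using E by auto
        then show ?thesis by blast
      next
        case 2
        then have "?R (Parallel D1 D2) (Parallel E1 E2)" using E disj by auto
        then show ?thesis by blast
      qed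
    qed
  qed
  then show ?thesis unfolding g_def .
qed

text \<open>Relaxes \<open>floral_vertex\<close>: coordinates may be missing from the diagram, as
  happens at nonsingular points. The empty cone stays excluded, because every diagram is true when
  all its inputs are.\<close>

definition read_once :: "'i set \<Rightarrow> ('i \<Rightarrow> real) set \<Rightarrow> bool" where
  "read_once A \<alpha> \<longleftrightarrow>
     (\<exists>D s. is_spd D \<and> edges D \<subseteq> A \<and> s \<in> signs A \<and> \<alpha> = spd_set A s D)"

lemma floral_vertex_imp_read_once: "floral_vertex A \<alpha> \<Longrightarrow> read_once A \<alpha>"
  unfolding floral_vertex_def read_once_def by blast


subsection \<open>Local arrangements and essential coordinates\<close>

lemma finite_pos_lower_bound:
  fixes f :: "'i \<Rightarrow> real"
  assumes "finite A" "\<And>i. i \<in> A \<Longrightarrow> 0 < f i"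
  obtains e where "0 < e" "\<And>i. i \<in> A \<Longrightarrow> e \<le> f i"
proof
  show "0 < Min (insert 1 (f ` A))" using assms by auto
  show "Min (insert 1 (f ` A)) \<le> f i" if "i \<in> A" for i using assms that by auto
qed

section \<open>Unions of orthants\<close>

lemma local_arrangement_subset: "local_arrangement A \<alpha> \<Longrightarrow> \<alpha> \<subseteq> coord_space A"
  by (auto simp: local_arrangement_def orthant_def)

lemma local_arrangement_sgn_cong:
  assumes "local_arrangement A \<alpha>" "x \<in> coord_space A" "y \<in> coord_space A"
    and "\<And>i. i \<in> A \<Longrightarrow> sgn (x i) = sgn (y i)"
  shows "x \<in> \<alpha> \<longleftrightarrow> y \<in> \<alpha>"
proof -
  have "(0 \<le> s * x i) = (0 \<le> s * y i)" if "i \<in> A" for s i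
    using assms(4)[OF that]
    by (auto simp: sgn_if zero_le_mult_iff split: if_splits)
  then have "x \<in> orthant A s \<longleftrightarrow> y \<in> orthant A s" for s
    using assms(2,3) by (auto simp: orthant_def)
  then show ?thesis using assms(1) by (auto simp: local_arrangement_def)
qed

lemma local_arrangement_zero:
  assumes "local_arrangement A \<alpha>" "\<alpha> \<noteq> {}"
  shows "(\<lambda>i\<in>A. 0) \<in> \<alpha>"
  using assms by (auto simp: local_arrangement_def orthant_def coord_space_def)

lemma local_arrangement_Un:
  assumes "local_arrangement A \<alpha>" "local_arrangement A \<beta>"
  shows "local_arrangement A (\<alpha> \<union> \<beta>)"
proof -
  obtain S T where "S \<subseteq> signs A" "\<alpha> = (\<Union>s\<in>S. orthant A s)"
    "T \<subseteq> signs A" "\<beta> = (\<Union>s\<in>T. orthant A s)"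
    using assms unfolding local_arrangement_def by blast
  then show ?thesis
    unfolding local_arrangement_def by (intro exI[of _ "S \<union> T"]) auto
qed

lemma local_arrangementI:
  assumes "\<And>x. x \<in> \<alpha> \<Longrightarrow> \<exists>s\<in>signs A. x \<in> orthant A s \<and> orthant A s \<subseteq> \<alpha>"
  shows "local_arrangement A \<alpha>"
  unfolding local_arrangement_def
  using assms by (intro exI[of _ "{s \<in> signs A. orthant A s \<subseteq> \<alpha>}"]) fast

text \<open>For a local arrangement this is the tangent cone at \<open>y\<close>: next to a nonzero
  \<open>y i\<close> a small displacement cannot change the sign, so only the coordinates with
  \<open>y i = 0\<close> remain free.\<close>

definition localization ::
    "'i set \<Rightarrow> ('i \<Rightarrow> real) set \<Rightarrow> ('i \<Rightarrow> real) \<Rightarrow> ('i \<Rightarrow> real) set" where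
  "localization A \<alpha> y =
     {x \<in> coord_space A. (\<lambda>i\<in>A. if y i \<noteq> 0 then y i else x i) \<in> \<alpha>}"

lemma local_arrangement_localization:
  assumes "local_arrangement A \<alpha>"
  shows "local_arrangement A (localization A \<alpha> y)"
proof (rule local_arrangementI)
  fix x assume x: "x \<in> localization A \<alpha> y"
  obtain S where S: "S \<subseteq> signs A" "\<alpha> = (\<Union>s\<in>S. orthant A s)"
    using assms unfolding local_arrangement_def by blast
  obtain s where s: "s \<in> S" "(\<lambda>i\<in>A. if y i \<noteq> 0 then y i else x i) \<in> orthant A s"
    using x S by (auto simp: localization_def)
  define t where "t = (\<lambda>i. if y i \<noteq> 0 then if 0 \<le> x i then 1 else - 1 else s i)"
  have "s \<in> signs A" using s(1) S(1) by blast
  then have "t \<in> signs A" by (auto simp: t_def signs_def Pi_iff)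
  moreover have "0 \<le> t i * x i" if "i \<in> A" for i
    using s(2) that by (auto simp: t_def orthant_def)
  then have "x \<in> orthant A t" using x by (auto simp: orthant_def localization_def)
  moreover have "orthant A t \<subseteq> localization A \<alpha> y"
  proof
    fix z assume z: "z \<in> orthant A t"
    have "0 \<le> s i * (if y i \<noteq> 0 then y i else z i)" if "i \<in> A" for i
      using s(2) z that by (auto simp: orthant_def t_def dest!: bspec[of A _ i])
    then have "(\<lambda>i\<in>A. if y i \<noteq> 0 then y i else z i) \<in> orthant A s"
      by (auto simp: orthant_def coord_space_def)
    then show "z \<in> localization A \<alpha> y"
      using z s(1) S(2) unfolding localization_def by (auto simp only: orthant_def mem_Collect_eq)
  qed
  ultimately show "\<exists>t\<in>signs A. x \<in> orthant A t \<and> orthant A t \<subseteq> localization A \<alpha> y"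
    by blast
qed

lemma read_once_localization:
  assumes "read_once A \<alpha>" "localization A \<alpha> y \<noteq> {}"
  shows "read_once A (localization A \<alpha> y)"
proof -
  obtain D s where D: "is_spd D" "edges D \<subseteq> A" "s \<in> signs A" "\<alpha> = spd_set A s D"
    using assms(1) unfolding read_once_def by blast
  define J where "J = {i. y i \<noteq> 0}"
  define b where "b i = (0 \<le> s i * y i)" for i
  have eq: "spd_eval (\<lambda>i. 0 \<le> s i * (\<lambda>i\<in>A. if y i \<noteq> 0 then y i else x i) i) D =
      spd_eval (\<lambda>i. if i \<in> J then b i else 0 \<le> s i * x i) D" for x
    using D(2) by (intro spd_eval_cong) (auto simp: J_def b_def)
  have "(\<lambda>i\<in>A. if y i \<noteq> 0 then y i else x i) \<in> coord_space A" for x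
    by (simp add: coord_space_def)
  then have loc: "localization A \<alpha> y =
      {x \<in> coord_space A. spd_eval (\<lambda>i. if i \<in> J then b i else 0 \<le> s i * x i) D}"
    by (simp only: localization_def D(4) spd_set_eq_eval mem_Collect_eq eq simp_thms)
  then obtain x where "spd_eval (\<lambda>i. if i \<in> J then b i else 0 \<le> s i * x i) D"
    using assms(2) by auto
  then have "\<exists>f. spd_eval (\<lambda>i. if i \<in> J then b i else f i) D"
    by (rule exI[where x = "\<lambda>i. 0 \<le> s i * x i"])
  then obtain D' where "is_spd D'" "edges D' \<subseteq> edges D - J"
    "\<And>f. spd_eval (\<lambda>e. if e \<in> J then b e else f e) D = spd_eval f D'"
    using is_spd_freeze[OF D(1), of J b] by blast
  then show ?thesis
    unfolding read_once_def loc spd_set_eq_eval using D(2,3)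
    by (intro exI[of _ D'] exI[of _ s]) auto
qed

section \<open>Essential coordinates of a cone\<close>

definition essential :: "'i set \<Rightarrow> ('i \<Rightarrow> real) set \<Rightarrow> 'i set" where
  "essential A \<alpha> = {i \<in> A. \<exists>x\<in>coord_space A. \<exists>c. (x \<in> \<alpha>) \<noteq> (x(i := c) \<in> \<alpha>)}"

lemma essential_subset: "essential A \<alpha> \<subseteq> A"
  by (auto simp: essential_def)

lemma essentialI:
  "\<lbrakk>i \<in> A; x \<in> coord_space A; (x \<in> \<alpha>) \<noteq> (x(i := c) \<in> \<alpha>)\<rbrakk> \<Longrightarrow> i \<in> essential A \<alpha>"
  by (auto simp: essential_def)

lemma inessential_upd:
  assumes "i \<in> A" "i \<notin> essential A \<alpha>" "x \<in> coord_space A"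
  shows "x(i := c) \<in> \<alpha> \<longleftrightarrow> x \<in> \<alpha>"
  using assms by (auto simp: essential_def)

lemma coord_space_restrict: "x \<in> coord_space A \<Longrightarrow> restrict x A = x"
  by (simp add: coord_space_def PiE_restrict)

lemma coord_space_upd: "x \<in> coord_space A \<Longrightarrow> i \<in> A \<Longrightarrow> x(i := c) \<in> coord_space A"
  by (auto simp: coord_space_def PiE_def extensional_def)

text \<open>Freezing removes the dependence on coordinates with \<open>y i \<noteq> 0\<close>, and
  fixing some arguments cannot create dependence on the others.\<close>

lemma essential_localization:
  "essential A (localization A \<alpha> y) \<subseteq> {i \<in> essential A \<alpha>. y i = 0}"
proof
  fix i assume i: "i \<in> essential A (localization A \<alpha> y)"
  then obtain x c where A: "i \<in> A" and x: "x \<in> coord_space A"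
    and ne: "(x \<in> localization A \<alpha> y) \<noteq> (x(i := c) \<in> localization A \<alpha> y)"
    by (auto simp: essential_def)
  define m where "m x = (\<lambda>i\<in>A. if y i \<noteq> 0 then y i else x i)" for x
  have m: "m x \<in> coord_space A" by (simp add: m_def coord_space_def)
  have ne': "(m x \<in> \<alpha>) \<noteq> (m (x(i := c)) \<in> \<alpha>)"
    using ne x coord_space_upd[OF x A] by (simp add: localization_def m_def)
  have y: "y i = 0"
  proof (rule ccontr)
    assume "y i \<noteq> 0"
    then have "m (x(i := c)) = m x" by (auto simp: m_def)
    with ne' show False by simp
  qed
  then have "m (x(i := c)) = (m x)(i := c)" using A by (auto simp: m_def)
  with ne' m A have "i \<in> essential A \<alpha>" by (auto intro: essentialI)
  with y show "i \<in> {i \<in> essential A \<alpha>. y i = 0}" by simp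
qed

text \<open>Only coordinate \<open>i\<close> can be frozen here, and replacing its value is
  invisible to \<open>\<alpha>\<close>. This keeps the tangent cone constant along a short move in
  direction \<open>i\<close>.\<close>

lemma localization_inessential:
  assumes "\<alpha> \<subseteq> coord_space A" "i \<in> A" "i \<notin> essential A \<alpha>" "\<And>j. j \<in> A \<Longrightarrow> j \<noteq> i \<Longrightarrow> y j = 0"
  shows "localization A \<alpha> y = \<alpha>"
proof -
  have "x \<in> localization A \<alpha> y \<longleftrightarrow> x \<in> \<alpha>" if x: "x \<in> coord_space A" for x
  proof -
    have "(\<lambda>j\<in>A. if y j \<noteq> 0 then y j else x j) = x(i := if y i \<noteq> 0 then y i else x i)"
      using assms(2,4) x
      by (auto simp: coord_space_def PiE_def extensional_def restrict_def fun_eq_iff)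
    then show ?thesis
      using inessential_upd[OF assms(2,3) x] x by (simp add: localization_def)
  qed
  then show ?thesis using assms(1) by (auto simp: localization_def)
qed

lemma essential_spd_set:
  assumes "edges D \<subseteq> A"
  shows "essential A (spd_set A s D) \<subseteq> edges D"
proof
  fix i assume "i \<in> essential A (spd_set A s D)"
  then obtain x c where A: "i \<in> A" and x: "x \<in> coord_space A"
    and ne: "(x \<in> spd_set A s D) \<noteq> (x(i := c) \<in> spd_set A s D)"
    by (auto simp: essential_def)
  show "i \<in> edges D"
  proof (rule ccontr)
    assume "i \<notin> edges D"
    then have "spd_eval (\<lambda>j. 0 \<le> s j * (x(i := c)) j) D = spd_eval (\<lambda>j. 0 \<le> s j * x j) D"
      by (intro spd_eval_cong) auto
    then show False using ne x coord_space_upd[OF x A] by (simp add: spd_set_eq_eval)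
  qed
qed

section \<open>Congruence of cones\<close>

lemma congruent_cones_refl:
  assumes "\<alpha> \<subseteq> coord_space A"
  shows "congruent_cones A \<alpha> \<alpha>"
proof -
  have "(\<lambda>i\<in>A. 1 * x i) = x" if "x \<in> \<alpha>" for x
    using assms that coord_space_restrict by fastforce
  then have "\<alpha> = (\<lambda>x. \<lambda>i\<in>A. 1 * x (id i)) ` \<alpha>"
    unfolding id_apply by (metis (no_types, lifting) image_cong image_ident)
  then show ?thesis
    unfolding congruent_cones_def
    by (intro exI[of _ id] exI[of _ "\<lambda>_. 1"]) (auto simp: signs_def)
qed

text \<open>A signed permutation is injective on \<open>coord_space A\<close> and turns a change of
  coordinate \<open>\<pi> i\<close> into a change of coordinate \<open>i\<close>, so it permutes the
  essential coordinates.\<close>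

lemma congruent_cones_essential_all:
  assumes cong: "congruent_cones A \<alpha> \<beta>" and sub: "\<alpha> \<subseteq> coord_space A"
    and ess: "essential A \<alpha> = A"
  shows "essential A \<beta> = A"
proof -
  obtain \<pi> s where \<pi>: "bij_betw \<pi> A A" and s: "s \<in> signs A"
    and \<beta>: "\<beta> = (\<lambda>x. \<lambda>i\<in>A. s i * x (\<pi> i)) ` \<alpha>"
    using cong unfolding congruent_cones_def by blast
  define f where "f x = (\<lambda>i\<in>A. s i * x (\<pi> i))" for x
  have inj: "inj_on f (coord_space A)"
  proof (rule inj_onI)
    fix x y assume xy: "x \<in> coord_space A" "y \<in> coord_space A" "f x = f y"
    have "x j = y j" if j: "j \<in> A" for j
    proof -
      obtain i where i: "i \<in> A" "j = \<pi> i" using \<pi> j by (auto simp: bij_betw_def)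
      have "s i \<noteq> 0" using s i(1) by (auto simp: signs_def Pi_def)
      then show ?thesis using fun_cong[OF xy(3), of i] i by (simp add: f_def)
    qed
    then show "x = y" using xy(1,2) by (metis PiE_ext coord_space_def)
  qed
  have mem: "f x \<in> \<beta> \<longleftrightarrow> x \<in> \<alpha>" if "x \<in> coord_space A" for x
    using inj_on_image_mem_iff[OF inj that sub] by (simp add: \<beta> f_def)
  have "i \<in> essential A \<beta>" if i: "i \<in> A" for i
  proof -
    have pi: "\<pi> i \<in> A" using \<pi> i by (auto simp: bij_betw_def)
    then have "\<pi> i \<in> essential A \<alpha>" using ess by simp
    then obtain x c where x: "x \<in> coord_space A" "(x \<in> \<alpha>) \<noteq> (x(\<pi> i := c) \<in> \<alpha>)"
      unfolding essential_def by blast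
    have "f (x(\<pi> i := c)) = (f x)(i := s i * c)"
    proof
      fix j show "f (x(\<pi> i := c)) j = ((f x)(i := s i * c)) j"
        using \<pi> i by (cases "j \<in> A") (auto simp: f_def bij_betw_def inj_on_def)
    qed
    then have "(f x \<in> \<beta>) \<noteq> ((f x)(i := s i * c) \<in> \<beta>)"
      using mem[OF x(1)] mem[OF coord_space_upd[OF x(1) pi], of c] x(2) by simp
    moreover have "f x \<in> coord_space A" by (simp add: f_def coord_space_def)
    ultimately show ?thesis using i by (blast intro: essentialI)
  qed
  then show ?thesis using essential_subset[of A \<beta>] by blast
qed


subsection \<open>Tangent cones of orthogonal polytopes\<close>

text \<open>Translation by \<open>v\<close> is injective on a cube, so the equation of sets can be
  read pointwise in the displacement \<open>x\<close>.\<close>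

lemma is_tangent_cone_iff:
  "is_tangent_cone A P v \<alpha> \<longleftrightarrow> local_arrangement A \<alpha> \<and>
     (\<exists>\<delta>>0. \<forall>x\<in>cube A \<delta>. (\<lambda>i\<in>A. v i + x i) \<in> P \<longleftrightarrow> x \<in> \<alpha>)"
proof -
  have inj: "x = y" if "x \<in> cube A \<delta>" "y \<in> cube A \<delta>" "(\<lambda>i\<in>A. v i + x i) = (\<lambda>i\<in>A. v i + y i)"
    for x y \<delta>
  proof
    fix i show "x i = y i"
      using fun_cong[OF that(3), of i] that(1,2) by (cases "i \<in> A") (auto simp: cube_def PiE_iff extensional_def)
  qed
  have "P \<inter> translate A v (cube A \<delta>) = translate A v (\<alpha> \<inter> cube A \<delta>) \<longleftrightarrow>
      (\<forall>x\<in>cube A \<delta>. (\<lambda>i\<in>A. v i + x i) \<in> P \<longleftrightarrow> x \<in> \<alpha>)" (is "?L \<longleftrightarrow> ?R") for \<delta>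
  proof
    assume L: ?L
    show ?R
    proof
      fix x assume x: "x \<in> cube A \<delta>"
      have "(\<lambda>i\<in>A. v i + x i) \<in> P \<longleftrightarrow> (\<lambda>i\<in>A. v i + x i) \<in> translate A v (\<alpha> \<inter> cube A \<delta>)"
        using L x by (auto simp: translate_def)
      also have "\<dots> \<longleftrightarrow> x \<in> \<alpha>"
        using x inj[of x \<delta>] unfolding translate_def by blast
      finally show "(\<lambda>i\<in>A. v i + x i) \<in> P \<longleftrightarrow> x \<in> \<alpha>" .
    qed
  qed (auto simp: translate_def)
  then show ?thesis unfolding is_tangent_cone_def by simp
qed

lemma cube_mono: "\<delta> \<le> \<epsilon> \<Longrightarrow> cube A \<delta> \<subseteq> cube A \<epsilon>"
  unfolding cube_def by (intro PiE_mono) auto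

lemma cube_subset: "cube A \<delta> \<subseteq> coord_space A"
  by (auto simp: cube_def coord_space_def)

lemma is_tangent_cone_Un:
  assumes "is_tangent_cone A P v \<alpha>" "is_tangent_cone A Q v \<beta>"
  shows "is_tangent_cone A (P \<union> Q) v (\<alpha> \<union> \<beta>)"
proof -
  obtain d where a: "local_arrangement A \<alpha>" "d > 0"
      "\<forall>x\<in>cube A d. (\<lambda>i\<in>A. v i + x i) \<in> P \<longleftrightarrow> x \<in> \<alpha>"
    using assms(1) unfolding is_tangent_cone_iff by blast
  obtain e where b: "local_arrangement A \<beta>" "e > 0"
      "\<forall>x\<in>cube A e. (\<lambda>i\<in>A. v i + x i) \<in> Q \<longleftrightarrow> x \<in> \<beta>"
    using assms(2) unfolding is_tangent_cone_iff by blast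
  have "\<forall>x\<in>cube A (min d e). (\<lambda>i\<in>A. v i + x i) \<in> P \<union> Q \<longleftrightarrow> x \<in> \<alpha> \<union> \<beta>"
    using a(3) b(3) cube_mono[of "min d e" d A] cube_mono[of "min d e" e A] by auto
  then show ?thesis
    unfolding is_tangent_cone_iff
    using local_arrangement_Un[OF a(1) b(1)] a(2) b(2)
    by (intro conjI exI[of _ "min d e"]) auto
qed

text \<open>Near \<open>v i\<close> the interval from \<open>a i\<close> to \<open>b i\<close> looks
  empty, like a half-line or like the whole line. Since \<open>a i < b i\<close>, at most one
  endpoint equals \<open>v i\<close>, so the product is a union of orthants.\<close>

lemma is_tangent_cone_pure_box:
  assumes "finite A" "pure_box A B"
  shows "\<exists>\<alpha>. is_tangent_cone A B v \<alpha>"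
proof -
  obtain a b where ab: "\<And>i. i \<in> A \<Longrightarrow> a i < b i" and B: "B = (\<Pi>\<^sub>E i\<in>A. {a i..b i})"
    using assms(2) unfolding pure_box_def by blast
  \<comment> \<open>Half the distance to an endpoint keeps small displacements from reaching it;
    when \<open>v i\<close> is itself the endpoint, any positive default such as 1 serves.\<close>
  define g :: "real \<Rightarrow> real" where "g t = (if t = 0 then 1 else \<bar>t\<bar> / 2)" for t
  have g: "0 < g t" for t by (simp add: g_def)
  obtain \<delta> where \<delta>: "0 < \<delta>" "\<And>i. i \<in> A \<Longrightarrow> \<delta> \<le> min (g (v i - a i)) (g (v i - b i))"
    using finite_pos_lower_bound[OF assms(1), of "\<lambda>i. min (g (v i - a i)) (g (v i - b i))"] g
    by (metis min_less_iff_conj)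
  define \<alpha> where "\<alpha> = {x \<in> coord_space A. \<forall>i\<in>A. a i \<le> v i \<and> v i \<le> b i \<and>
      (v i = a i \<longrightarrow> 0 \<le> x i) \<and> (v i = b i \<longrightarrow> x i \<le> 0)}"
  have "local_arrangement A \<alpha>"
  proof (rule local_arrangementI)
    fix x assume x: "x \<in> \<alpha>"
    define s :: "'a \<Rightarrow> real" where
      "s i = (if v i = a i then 1 else if v i = b i then - 1 else if 0 \<le> x i then 1 else - 1)" for i
    have "s \<in> signs A" by (auto simp: s_def signs_def)
    moreover have "x \<in> orthant A s" using x by (auto simp: s_def orthant_def \<alpha>_def)
    moreover have "orthant A s \<subseteq> \<alpha>"
    proof
      fix z assume z: "z \<in> orthant A s"
      have "a i \<le> v i \<and> v i \<le> b i \<and> (v i = a i \<longrightarrow> 0 \<le> z i) \<and> (v i = b i \<longrightarrow> z i \<le> 0)"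
        if i: "i \<in> A" for i
      proof -
        have "a i \<le> v i" "v i \<le> b i" using x i by (auto simp: \<alpha>_def)
        moreover have "0 \<le> s i * z i" using z i by (auto simp: orthant_def)
        ultimately show ?thesis using ab[OF i] by (auto simp: s_def)
      qed
      then show "z \<in> \<alpha>" using z by (auto simp: \<alpha>_def orthant_def)
    qed
    ultimately show "\<exists>s\<in>signs A. x \<in> orthant A s \<and> orthant A s \<subseteq> \<alpha>" by blast
  qed
  moreover have "(\<lambda>i\<in>A. v i + x i) \<in> B \<longleftrightarrow> x \<in> \<alpha>" if x: "x \<in> cube A \<delta>" for x
  proof -
    have "(a i \<le> v i + x i \<and> v i + x i \<le> b i) \<longleftrightarrow> a i \<le> v i \<and> v i \<le> b i \<and>
      (v i = a i \<longrightarrow> 0 \<le> x i) \<and> (v i = b i \<longrightarrow> x i \<le> 0)" if i: "i \<in> A" for i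
    proof -
      have "- \<delta> \<le> x i" "x i \<le> \<delta>" using x i by (auto simp: cube_def PiE_iff)
      then have "\<bar>x i\<bar> \<le> g (v i - a i)" "\<bar>x i\<bar> \<le> g (v i - b i)" using \<delta>(2)[OF i] by auto
      then show ?thesis
        using ab[OF i] unfolding g_def by (auto simp: abs_if split: if_splits)
    qed
    then show ?thesis
      using x cube_subset[of A \<delta>] unfolding B \<alpha>_def by (auto simp: PiE_iff)
  qed
  ultimately show ?thesis unfolding is_tangent_cone_iff using \<delta>(1) by blast
qed

text \<open>The point need not lie in P; outside of P the tangent cone is empty.\<close>

lemma is_tangent_cone_exists:
  assumes "finite A" "pure_orthogonal_polytope A P"
  shows "\<exists>\<alpha>. is_tangent_cone A P v \<alpha>"
proof -
  obtain \<B> where "finite \<B>" "\<forall>B\<in>\<B>. pure_box A B" "P = \<Union>\<B>"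
    using assms(2) unfolding pure_orthogonal_polytope_def by blast
  moreover have "\<exists>\<alpha>. is_tangent_cone A (\<Union>\<B>) v \<alpha>"
    if "finite \<B>" "\<forall>B\<in>\<B>. pure_box A B" for \<B>
    using that
  proof (induction \<B>)
    case empty
    have "is_tangent_cone A {} v {}"
      unfolding is_tangent_cone_iff local_arrangement_def by (auto intro: exI[of _ 1])
    then show ?case by auto
  next
    case (insert B \<B>)
    then obtain \<alpha> \<beta> where "is_tangent_cone A (\<Union>\<B>) v \<alpha>" "is_tangent_cone A B v \<beta>"
      using is_tangent_cone_pure_box[OF assms(1)] by (metis insertI1 insertI2)
    from is_tangent_cone_Un[OF this(2,1)] show ?case by auto
  qed
  ultimately show ?thesis by blast
qed

lemma is_tangent_cone_tangent_cone:
  assumes "finite A" "pure_orthogonal_polytope A P"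
  shows "is_tangent_cone A P v (tangent_cone A P v)"
  using is_tangent_cone_exists[OF assms] tangent_cone_eq[OF assms(1)] by metis

text \<open>A nonempty union of orthants contains the origin, and the origin of the cone corresponds
  to \<open>v\<close>.\<close>

lemma is_tangent_cone_mem_iff:
  assumes "is_tangent_cone A P v \<alpha>" "v \<in> coord_space A"
  shows "v \<in> P \<longleftrightarrow> \<alpha> \<noteq> {}"
proof -
  obtain d where a: "local_arrangement A \<alpha>" "d > 0"
      "\<forall>x\<in>cube A d. (\<lambda>i\<in>A. v i + x i) \<in> P \<longleftrightarrow> x \<in> \<alpha>"
    using assms(1) unfolding is_tangent_cone_iff by blast
  have "(\<lambda>i\<in>A. v i + (\<lambda>i\<in>A. 0) i) = v"
    using assms(2) by (auto simp: coord_space_def PiE_def extensional_def)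
  moreover have "(\<lambda>i\<in>A. 0) \<in> cube A d" using a(2) by (auto simp: cube_def)
  ultimately have "v \<in> P \<longleftrightarrow> (\<lambda>i\<in>A. 0) \<in> \<alpha>" using a(3) by metis
  then show ?thesis using local_arrangement_zero[OF a(1)] by blast
qed

text \<open>In a small enough cube around \<open>w\<close> the nonzero differences
  \<open>w i - v i\<close> keep their signs, and membership in a cone depends on signs only.\<close>

lemma is_tangent_cone_nearby:
  assumes "finite A" "is_tangent_cone A P v \<alpha>"
  shows "\<exists>\<delta>>0. \<forall>w. (\<forall>i\<in>A. \<bar>w i - v i\<bar> < \<delta>) \<longrightarrow>
    is_tangent_cone A P w (localization A \<alpha> (\<lambda>i. w i - v i))"
proof -
  obtain d where a: "local_arrangement A \<alpha>" "d > 0"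
      "\<forall>x\<in>cube A d. (\<lambda>i\<in>A. v i + x i) \<in> P \<longleftrightarrow> x \<in> \<alpha>"
    using assms(2) unfolding is_tangent_cone_iff by blast
  have "is_tangent_cone A P w (localization A \<alpha> (\<lambda>i. w i - v i))"
    if w: "\<forall>i\<in>A. \<bar>w i - v i\<bar> < d" for w
  proof -
    define y where "y i = w i - v i" for i
    \<comment> \<open>The bound \<open>d - \<bar>y i\<bar>\<close> keeps the point in the cube of
      radius \<open>d\<close> around \<open>v\<close>; half of \<open>\<bar>y i\<bar>\<close>
      prevents a change of sign.\<close>
    define f where "f i = (if y i = 0 then d else min (d - \<bar>y i\<bar>) (\<bar>y i\<bar> / 2))" for i
    have "0 < f i" if "i \<in> A" for i using bspec[OF w that] a(2) by (auto simp: f_def y_def)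
    then obtain e where e: "0 < e" "\<And>i. i \<in> A \<Longrightarrow> e \<le> f i"
      using finite_pos_lower_bound[OF assms(1)] by metis
    have "(\<lambda>i\<in>A. w i + x i) \<in> P \<longleftrightarrow> x \<in> localization A \<alpha> y" if x: "x \<in> cube A e" for x
    proof -
      define z where "z = (\<lambda>i\<in>A. y i + x i)"
      define m where "m = (\<lambda>i\<in>A. if y i \<noteq> 0 then y i else x i)"
      have xi: "\<bar>x i\<bar> \<le> f i" if "i \<in> A" for i
      proof -
        have "- e \<le> x i" "x i \<le> e" using x that by (auto simp: cube_def PiE_iff)
        then show ?thesis using e(2)[OF that] by auto
      qed
      have "- d \<le> y i + x i \<and> y i + x i \<le> d" if "i \<in> A" for i
        using xi[OF that] by (auto simp: f_def abs_if split: if_splits)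
      then have "z \<in> cube A d" by (auto simp: z_def cube_def)
      then have "(\<lambda>i\<in>A. v i + z i) \<in> P \<longleftrightarrow> z \<in> \<alpha>" using a(3) by blast
      moreover have "(\<lambda>i\<in>A. v i + z i) = (\<lambda>i\<in>A. w i + x i)" by (auto simp: z_def y_def)
      moreover have "z \<in> \<alpha> \<longleftrightarrow> m \<in> \<alpha>"
      proof (rule local_arrangement_sgn_cong[OF a(1)])
        show "z \<in> coord_space A" "m \<in> coord_space A" by (auto simp: z_def m_def coord_space_def)
        show "sgn (z i) = sgn (m i)" if "i \<in> A" for i
          using xi[OF that] that
          by (auto simp: z_def m_def f_def sgn_if abs_if split: if_splits)
      qed
      ultimately show ?thesis
        using x cube_subset[of A e] by (auto simp: localization_def m_def)
    qed
    then show ?thesis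
      unfolding is_tangent_cone_iff y_def[symmetric]
      using local_arrangement_localization[OF a(1)] e(1) by blast
  qed
  with a(2) show ?thesis by blast
qed

lemma pure_orthogonal_polytope_subset:
  "pure_orthogonal_polytope A P \<Longrightarrow> P \<subseteq> coord_space A"
  by (fastforce simp: pure_orthogonal_polytope_def pure_box_def coord_space_def)

lemma pure_orthogonal_polytope_bdd_above:
  assumes "pure_orthogonal_polytope A P" "i \<in> A"
  obtains M where "\<And>x. x \<in> P \<Longrightarrow> x i \<le> M"
proof -
  obtain \<B> where B: "finite \<B>" "\<forall>B\<in>\<B>. pure_box A B" "P = \<Union>\<B>"
    using assms(1) unfolding pure_orthogonal_polytope_def by blast
  have "bdd_above (\<Union>B\<in>\<B>. (\<lambda>x. x i) ` B)"
  proof (subst bdd_above_UN[OF B(1)], intro ballI)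
    fix B assume "B \<in> \<B>"
    then obtain a b where "B = (\<Pi>\<^sub>E i\<in>A. {a i..b i})" using B(2) unfolding pure_box_def by blast
    then show "bdd_above ((\<lambda>x. x i) ` B)"
      using assms(2) by (intro bdd_aboveI[of _ "b i"]) (auto simp: PiE_iff)
  qed
  then obtain M where "\<forall>y\<in>(\<Union>B\<in>\<B>. (\<lambda>x. x i) ` B). y \<le> M" by (auto simp: bdd_above_def)
  then show ?thesis using B(3) by (intro that[of M]) auto
qed

lemma tangent_cone_subset:
  assumes "finite A" "pure_orthogonal_polytope A P"
  shows "tangent_cone A P v \<subseteq> coord_space A"
  using is_tangent_cone_tangent_cone[OF assms, of v]
  by (auto simp: is_tangent_cone_iff dest: local_arrangement_subset)

lemma tangent_cone_nearby:
  assumes "finite A" "pure_orthogonal_polytope A P"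
  shows "\<exists>\<delta>>0. \<forall>w. (\<forall>i\<in>A. \<bar>w i - v i\<bar> < \<delta>) \<longrightarrow>
    tangent_cone A P w = localization A (tangent_cone A P v) (\<lambda>i. w i - v i)"
  using is_tangent_cone_nearby[OF assms(1) is_tangent_cone_tangent_cone[OF assms], of v]
    tangent_cone_eq[OF assms(1)] by blast

lemma tangent_cone_move_inessential:
  assumes "finite A" "pure_orthogonal_polytope A P" "i \<in> A"
    and "i \<notin> essential A (tangent_cone A P v)"
  shows "\<exists>\<delta>>0. \<forall>t. \<bar>t\<bar> < \<delta> \<longrightarrow>
    tangent_cone A P (v(i := v i + t)) = tangent_cone A P v"
proof -
  obtain \<delta> where \<delta>: "\<delta> > 0"
    "\<forall>w. (\<forall>i\<in>A. \<bar>w i - v i\<bar> < \<delta>) \<longrightarrow>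
       tangent_cone A P w = localization A (tangent_cone A P v) (\<lambda>i. w i - v i)"
    using tangent_cone_nearby[OF assms(1,2)] by blast
  have "tangent_cone A P (v(i := v i + t)) = tangent_cone A P v" if "\<bar>t\<bar> < \<delta>" for t
  proof -
    have "tangent_cone A P (v(i := v i + t)) =
        localization A (tangent_cone A P v) (\<lambda>j. (v(i := v i + t)) j - v j)"
      using that \<delta>(1) by (intro \<delta>(2)[rule_format]) auto
    also have "\<dots> = tangent_cone A P v"
      using assms by (intro localization_inessential[of _ _ i] tangent_cone_subset) auto
    finally show ?thesis .
  qed
  with \<delta>(1) show ?thesis by blast
qed


subsection \<open>Singular points\<close>

text \<open>Congruence keeps every coordinate essential along a path in the genericity region, while
  any small nonzero displacement would make some coordinate inessential. Hence such paths are
  locally constant, and the region has no point other than \<open>v\<close>.\<close>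

lemma singular_if_essential_all:
  fixes A :: "'i set"
  assumes fin: "finite A" and P: "pure_orthogonal_polytope A P" and v: "v \<in> P"
    and ess: "essential A (tangent_cone A P v) = A"
  shows "singular A P v"
proof -
  have "w = v" if "w \<in> genericity_region A P v" for w
  proof -
    obtain g where g: "path g" "path_image g \<subseteq> P" "pathstart g = v" "pathfinish g = w"
      "\<forall>t\<in>{0..1}. congruent_cones A (tangent_cone A P v) (tangent_cone A P (g t))"
      using \<open>w \<in> genericity_region A P v\<close> unfolding genericity_region_def by blast
    have gP: "g t \<in> P" if "t \<in> {0..1}" for t using g(2) that by (auto simp: path_image_def)
    have E: "essential A (tangent_cone A P (g t)) = A" if "t \<in> {0..1}" for t
      using congruent_cones_essential_all[OF bspec[OF g(5) that] tangent_cone_subset[OF fin P] ess] .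
    have "eventually (\<lambda>u. g t = g u) (at t within {0..1})" if t: "t \<in> {0..1}" for t
    proof -
      obtain \<delta> where \<delta>: "\<delta> > 0"
        "\<forall>w. (\<forall>i\<in>A. \<bar>w i - g t i\<bar> < \<delta>) \<longrightarrow>
          tangent_cone A P w = localization A (tangent_cone A P (g t)) (\<lambda>i. w i - g t i)"
        using tangent_cone_nearby[OF fin P] by blast
      have "eventually (\<lambda>u. \<bar>g u i - g t i\<bar> < \<delta>) (at t within {0..1})" for i
      proof -
        have "continuous_on {0..1} (\<lambda>u. g u i)"
          using g(1) unfolding path_def by (rule continuous_on_product_then_coordinatewise)
        then have "((\<lambda>u. g u i) \<longlongrightarrow> g t i) (at t within {0..1})"
          using t by (simp add: continuous_on_def)
        from tendstoD[OF this \<delta>(1)] show ?thesis by (simp add: dist_real_def)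
      qed
      then have "eventually (\<lambda>u. \<forall>i\<in>A. \<bar>g u i - g t i\<bar> < \<delta>) (at t within {0..1})"
        using fin by (simp add: eventually_ball_finite)
      moreover have "eventually (\<lambda>u. u \<in> {0..1}) (at t within {0..1})"
        by (simp add: eventually_at_filter)
      ultimately show ?thesis
      proof eventually_elim
        case (elim u)
        then have "tangent_cone A P (g u) =
            localization A (tangent_cone A P (g t)) (\<lambda>i. g u i - g t i)"
          using \<delta>(2) by blast
        \<comment> \<open>The cone at \<open>g u\<close> is a localization of the one at
          \<open>g t\<close>, in which every coordinate that moved would be inessential.\<close>
        then have "A \<subseteq> {i. g u i - g t i = 0}"
          using E[OF elim(2)] essential_localization[of A "tangent_cone A P (g t)"] by fastforce
        moreover have "g u \<in> coord_space A" "g t \<in> coord_space A"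
          using gP t elim(2) pure_orthogonal_polytope_subset[OF P] by auto
        ultimately show "g t = g u"
          unfolding coord_space_def by (intro PiE_ext) auto
      qed
    qed
    then have "g 0 = g 1"
      by (intro connected_local_const[of "{0..1::real}" 0 1 g]) auto
    then show "w = v" using g(3,4) by (simp add: pathstart_def pathfinish_def)
  qed
  moreover have "v \<in> coord_space A" using v pure_orthogonal_polytope_subset[OF P] by auto
  ultimately have "genericity_region A P v \<subseteq> gen_hyperplane A A v"
    by (auto simp: gen_hyperplane_def)
  then have "region_degree A P v \<le> 0"
    unfolding region_degree_def by (intro Least_le exI[of _ A] exI[of _ v]) auto
  then show ?thesis using v by (simp add: singular_def)
qed

text \<open>Moving along an inessential coordinate keeps the tangent cone, so the genericity region
  contains two points that differ in that coordinate; degree 0, however, fixes all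
  coordinates.\<close>

lemma singular_imp_essential_all:
  assumes fin: "finite A" and P: "pure_orthogonal_polytope A P" and sing: "singular A P v"
  shows "essential A (tangent_cone A P v) = A"
proof (rule ccontr)
  assume "essential A (tangent_cone A P v) \<noteq> A"
  then obtain i where i: "i \<in> A" "i \<notin> essential A (tangent_cone A P v)"
    using essential_subset[of A "tangent_cone A P v"] by blast
  note sub = pure_orthogonal_polytope_subset[OF P]
  have v: "v \<in> P" "v \<in> coord_space A" using sing sub by (auto simp: singular_def)
  \<comment> \<open>The empty index set shows that the minimum in \<open>region_degree\<close> is
    taken over a nonempty set, so degree 0 is attained by some \<open>J\<close>.\<close>
  have "\<exists>n J l. J \<subseteq> A \<and> n = card A - card J \<and> genericity_region A P v \<subseteq> gen_hyperplane A J l"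
    using sub by (intro exI[of _ "card A"] exI[of _ "{}"])
      (auto simp: gen_hyperplane_def genericity_region_def)
  from LeastI_ex[OF this] obtain J l where J: "J \<subseteq> A" "0 = card A - card J"
      "genericity_region A P v \<subseteq> gen_hyperplane A J l"
    using sing unfolding singular_def region_degree_def by auto
  then have "J = A" using fin by (simp add: card_seteq)
  obtain \<delta> where \<delta>: "\<delta> > 0"
    "\<forall>t. \<bar>t\<bar> < \<delta> \<longrightarrow> tangent_cone A P (v(i := v i + t)) = tangent_cone A P v"
    using tangent_cone_move_inessential[OF fin P i] by blast
  \<comment> \<open>Half of \<open>\<delta>\<close> keeps the whole segment, endpoint included,
    strictly within the range where the cone is constant.\<close>
  define g where "g t = v(i := v i + t * (\<delta> / 2))" for t
  have T: "tangent_cone A P (g t) = tangent_cone A P v" if "t \<in> {0..1}" for t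
  proof -
    have "t * (\<delta> / 2) \<le> 1 * (\<delta> / 2)" using that \<delta>(1) by (intro mult_right_mono) auto
    then have "\<bar>t * (\<delta> / 2)\<bar> < \<delta>" using that \<delta>(1) by (simp add: abs_mult)
    then show ?thesis unfolding g_def using \<delta>(2) by blast
  qed
  have gP: "g t \<in> P" if "t \<in> {0..1}" for t
    using T[OF that] is_tangent_cone_mem_iff[OF is_tangent_cone_tangent_cone[OF fin P]] v i(1)
    by (metis coord_space_upd g_def)
  have "path g" unfolding path_def
  proof (rule continuous_on_coordinatewise_then_product)
    fix j show "continuous_on {0..1} (\<lambda>t. g t j)"
      by (cases "j = i") (auto simp: g_def intro!: continuous_intros)
  qed
  moreover have "pathstart g = v" "pathfinish g = g 1"
    by (auto simp: pathstart_def pathfinish_def g_def)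
  moreover have "path_image g \<subseteq> P" using gP by (auto simp: path_image_def)
  ultimately have mem: "g t \<in> genericity_region A P v" if "t \<in> {0, 1}" for t
  proof -
    have c: "congruent_cones A (tangent_cone A P v) (tangent_cone A P v)"
      by (intro congruent_cones_refl tangent_cone_subset fin P)
    have "g 1 \<in> genericity_region A P v"
      using \<open>path g\<close> \<open>pathstart g = v\<close> \<open>pathfinish g = g 1\<close> \<open>path_image g \<subseteq> P\<close> gP[of 1] T c
      unfolding genericity_region_def by auto
    moreover have "v \<in> genericity_region A P v"
      using v c unfolding genericity_region_def
      by (auto intro!: exI[of _ "\<lambda>_. v"] simp: path_def path_image_def pathstart_def pathfinish_def)
    ultimately show ?thesis using that by (auto simp: g_def)
  qed
  from mem[of 0] mem[of 1] have "g 0 i = l i" "g 1 i = l i"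
    using J(3) \<open>J = A\<close> i(1) by (auto simp: gen_hyperplane_def)
  then show False using \<delta>(1) by (simp add: g_def)
qed


subsection \<open>Tangent cones of generic orthotopes\<close>

text \<open>Walk from \<open>v\<close> in direction \<open>i\<close> to the first parameter
  \<open>u\<close> where the tangent cone changes; boundedness of \<open>P\<close> forces a change.
  The cone before is a localization of the one at \<open>p u\<close>, where \<open>i\<close> has
  become essential and nothing essential is lost.\<close>

lemma tangent_cone_more_essential:
  assumes fin: "finite A" and P: "pure_orthogonal_polytope A P" and v: "v \<in> P"
    and i: "i \<in> A" "i \<notin> essential A (tangent_cone A P v)"
  obtains w y where "w \<in> P" "tangent_cone A P v = localization A (tangent_cone A P w) y"
    "essential A (tangent_cone A P v) \<subset> essential A (tangent_cone A P w)"
proof -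
  define \<alpha> where "\<alpha> = tangent_cone A P v"
  define p where "p t = v(i := v i + t)" for t
  define T where "T = {t. 0 \<le> t \<and> tangent_cone A P (p t) \<noteq> \<alpha>}"
  have vA: "v \<in> coord_space A" using v pure_orthogonal_polytope_subset[OF P] by auto
  have pA: "p t \<in> coord_space A" for t unfolding p_def using vA i(1) by (rule coord_space_upd)
  note mem_iff = is_tangent_cone_mem_iff[OF is_tangent_cone_tangent_cone[OF fin P]]
  have \<alpha>: "\<alpha> \<noteq> {}" using mem_iff[OF vA] v by (simp add: \<alpha>_def)
  obtain M where M: "\<And>x. x \<in> P \<Longrightarrow> x i \<le> M"
    using pure_orthogonal_polytope_bdd_above[OF P i(1)] by metis
  \<comment> \<open>Large enough that \<open>p t1\<close> exceeds the bound \<open>M\<close> in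
    coordinate \<open>i\<close>; outside \<open>P\<close> the cone is empty, which gives an element
    of \<open>T\<close>.\<close>
  define t1 where "t1 = \<bar>M\<bar> + \<bar>v i\<bar> + 1"
  have "p t1 \<notin> P" using M[of "p t1"] by (auto simp: p_def t1_def)
  then have "t1 \<in> T" using mem_iff[OF pA, of t1] \<alpha> by (auto simp: T_def t1_def)
  define u where "u = Inf T"
  have bdd: "bdd_below T" by (auto simp: T_def bdd_below_def)
  have before: "tangent_cone A P (p t) = \<alpha>" if "0 \<le> t" "t < u" for t
    using that cInf_lower[OF _ bdd, of t] by (force simp: T_def u_def)
  have lower: "b \<le> u" if "\<And>t. 0 \<le> t \<Longrightarrow> t < b \<Longrightarrow> tangent_cone A P (p t) = \<alpha>" for b
    unfolding u_def using that \<open>t1 \<in> T\<close> by (intro cInf_greatest) (force simp: T_def)+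
  have pp: "(p t)(i := p t i + r) = p (t + r)" for t r by (simp add: p_def algebra_simps)
  obtain d0 where d0: "d0 > 0" "\<forall>t. \<bar>t\<bar> < d0 \<longrightarrow> tangent_cone A P (p t) = \<alpha>"
    using tangent_cone_move_inessential[OF fin P i] unfolding p_def \<alpha>_def by blast
  have u: "0 < u" using lower[of d0] d0 by force
  define \<beta> where "\<beta> = tangent_cone A P (p u)"
  obtain \<delta> where \<delta>: "\<delta> > 0"
    "\<forall>w. (\<forall>i\<in>A. \<bar>w i - p u i\<bar> < \<delta>) \<longrightarrow>
       tangent_cone A P w = localization A \<beta> (\<lambda>i. w i - p u i)"
    using tangent_cone_nearby[OF fin P] unfolding \<beta>_def by blast
  \<comment> \<open>A parameter just before \<open>u\<close>, close enough for the cone at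
    \<open>p u\<close> to determine the one at \<open>p t\<close>; the maximum with 0 keeps it on
    the walk.\<close>
  define t where "t = max 0 (u - \<delta> / 2)"
  have t: "0 \<le> t" "t < u" "u - t < \<delta>" using u \<delta>(1) by (auto simp: t_def)
  define y where "y = (\<lambda>j. p t j - p u j)"
  have "tangent_cone A P (p t) = localization A \<beta> y"
    unfolding y_def using t \<delta>(1) by (intro \<delta>(2)[rule_format]) (auto simp: p_def)
  then have loc: "\<alpha> = localization A \<beta> y" using before t by simp
  have "localization A {} y = {}" by (simp add: localization_def)
  with loc \<alpha> have "\<beta> \<noteq> {}" by metis
  then have w: "p u \<in> P" using mem_iff[OF pA] by (simp add: \<beta>_def)
  \<comment> \<open>If \<open>i\<close> were inessential at \<open>p u\<close>, the cone would be
    unchanged there and on a stretch beyond, against the choice of \<open>u\<close> as an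
    infimum.\<close>
  have iess: "i \<in> essential A \<beta>"
  proof (rule ccontr)
    assume ni: "i \<notin> essential A \<beta>"
    have "\<beta> = \<alpha>"
      unfolding loc using ni i(1)
      by (intro localization_inessential[symmetric, of _ _ i])
        (auto simp: y_def p_def \<beta>_def tangent_cone_subset[OF fin P, THEN subsetD])
    obtain e where e: "e > 0" "\<forall>r. \<bar>r\<bar> < e \<longrightarrow> tangent_cone A P (p (u + r)) = \<beta>"
      using tangent_cone_move_inessential[OF fin P i(1), of "p u"] ni
      unfolding \<beta>_def pp by blast
    have "tangent_cone A P (p r) = \<alpha>" if "0 \<le> r" "r < u + e" for r
    proof (cases "r < u")
      case True
      then show ?thesis using before that by simp
    next
      case False
      then show ?thesis using e(2)[rule_format, of "r - u"] that \<open>\<beta> = \<alpha>\<close> by simp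
    qed
    then show False using lower[of "u + e"] e(1) by simp
  qed
  have "y i \<noteq> 0" using t by (simp add: y_def p_def)
  then have "essential A \<alpha> \<subset> essential A \<beta>"
    using essential_localization[of A \<beta> y] iess unfolding loc by blast
  with w loc show ?thesis by (intro that[of "p u" y]) (simp_all add: \<alpha>_def \<beta>_def)
qed

text \<open>Induction on the number of inessential coordinates: with none left the point is singular
  and its cone floral; otherwise the cone is a nonempty localization of one with more essential
  coordinates.\<close>

lemma generic_orthotope_tangent_cone:
  assumes fin: "finite A" and gen: "generic_orthotope A P" and v: "v \<in> P"
  shows "read_once A (tangent_cone A P v)"
  using v
proof (induction "card (A - essential A (tangent_cone A P v))" arbitrary: v rule: less_induct)
  case less
  have P: "pure_orthogonal_polytope A P" using gen by (simp add: generic_orthotope_def)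
  show ?case
  proof (cases "essential A (tangent_cone A P v) = A")
    case True
    then show ?thesis
      using singular_if_essential_all[OF fin P less.prems] gen
      by (auto simp: generic_orthotope_def intro: floral_vertex_imp_read_once)
  next
    case False
    then obtain i where i: "i \<in> A" "i \<notin> essential A (tangent_cone A P v)"
      using essential_subset[of A "tangent_cone A P v"] by blast
    obtain w y where w: "w \<in> P"
      "tangent_cone A P v = localization A (tangent_cone A P w) y"
      "essential A (tangent_cone A P v) \<subset> essential A (tangent_cone A P w)"
      using tangent_cone_more_essential[OF fin P less.prems i] by blast
    have "A - essential A (tangent_cone A P w) \<subset> A - essential A (tangent_cone A P v)"
      using w(3) essential_subset[of A "tangent_cone A P w"] by blast
    then have "read_once A (tangent_cone A P w)"
      using fin w(1) by (intro less.hyps psubset_card_mono) auto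
    moreover have "tangent_cone A P v \<noteq> {}"
      using is_tangent_cone_mem_iff[OF is_tangent_cone_tangent_cone[OF fin P]] less.prems
        pure_orthogonal_polytope_subset[OF P] by blast
    ultimately show ?thesis using read_once_localization w(2) by metis
  qed
qed


subsection \<open>Slices\<close>

text \<open>For \<open>I \<subseteq> A\<close> this inverts \<open>forget\<close> on the hyperplane.
  With zero in place of \<open>l\<close> it embeds displacements instead of points.\<close>

definition extend :: "'i set \<Rightarrow> 'i set \<Rightarrow> ('i \<Rightarrow> real) \<Rightarrow> ('i \<Rightarrow> real) \<Rightarrow> ('i \<Rightarrow> real)" where
  "extend A I l x = (\<lambda>i\<in>A. if i \<in> I then l i else x i)"

lemma extend_mem: "extend A I l x \<in> coord_space A"
  by (simp add: extend_def coord_space_def)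

lemma mem_slice_iff:
  assumes "I \<subseteq> A"
  shows "x \<in> forget A I ` (P \<inter> gen_hyperplane A I l) \<longleftrightarrow>
    x \<in> coord_space (A - I) \<and> extend A I l x \<in> P" (is "?L \<longleftrightarrow> ?R")
proof
  assume ?L
  then obtain z where z: "z \<in> P" "z \<in> gen_hyperplane A I l" "x = forget A I z" by auto
  have "extend A I l x = z"
    using z(2,3) assms
    by (auto simp: extend_def forget_def gen_hyperplane_def coord_space_def PiE_def extensional_def)
  then show ?R using z by (auto simp: forget_def coord_space_def)
next
  assume R: ?R
  then have "x = forget A I (extend A I l x)"
    by (auto simp: extend_def forget_def coord_space_def PiE_def extensional_def)
  moreover have "extend A I l x \<in> gen_hyperplane A I l"
    using assms extend_mem[of A I l x] by (auto simp: gen_hyperplane_def extend_def)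
  ultimately show ?L using R by blast
qed

text \<open>A slice of a box is empty or the box on the remaining sides, which are still
  nondegenerate. Empty slices are discarded, since the empty set is not a pure box.\<close>

lemma pure_orthogonal_polytope_slice:
  assumes I: "I \<subseteq> A" and P: "pure_orthogonal_polytope A P"
  shows "pure_orthogonal_polytope (A - I) (forget A I ` (P \<inter> gen_hyperplane A I l))"
proof -
  obtain \<B> where B: "finite \<B>" "\<And>B. B \<in> \<B> \<Longrightarrow> pure_box A B" "P = \<Union>\<B>"
    using P unfolding pure_orthogonal_polytope_def by blast
  define S where "S B = forget A I ` (B \<inter> gen_hyperplane A I l)" for B
  have box: "pure_box (A - I) (S B)" if mem: "B \<in> \<B>" and ne: "S B \<noteq> {}" for B
  proof -
    obtain a b where ab: "\<forall>i\<in>A. a i < b i" "B = (\<Pi>\<^sub>E i\<in>A. {a i..b i})"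
      using B(2)[OF mem] unfolding pure_box_def by blast
    obtain x where "x \<in> S B" using ne by blast
    then have "extend A I l x \<in> B" unfolding S_def mem_slice_iff[OF I] by simp
    then have l: "l i \<in> {a i..b i}" if "i \<in> I" for i
      using that I unfolding ab(2) extend_def by (force simp: PiE_iff)
    have "z \<in> S B \<longleftrightarrow> z \<in> (\<Pi>\<^sub>E i\<in>A - I. {a i..b i})" for z
      unfolding S_def mem_slice_iff[OF I] ab(2) extend_def coord_space_def
      using l by (auto simp: PiE_iff)
    then have "S B = (\<Pi>\<^sub>E i\<in>A - I. {a i..b i})" by blast
    then show ?thesis unfolding pure_box_def using ab(1) by blast
  qed
  have "forget A I ` (P \<inter> gen_hyperplane A I l) = \<Union>{S B |B. B \<in> \<B> \<and> S B \<noteq> {}}"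
    unfolding B(3) S_def by blast
  moreover have "finite {S B |B. B \<in> \<B> \<and> S B \<noteq> {}}" using B(1) by simp
  moreover have "\<forall>C\<in>{S B |B. B \<in> \<B> \<and> S B \<noteq> {}}. pure_box (A - I) C" using box by blast
  ultimately show ?thesis unfolding pure_orthogonal_polytope_def by blast
qed

text \<open>Zero coordinates satisfy the sign conditions in \<open>I\<close>, so each orthant
  restricts to an orthant.\<close>

lemma local_arrangement_slice:
  assumes "I \<subseteq> A" "local_arrangement A \<alpha>"
  shows "local_arrangement (A - I) {x \<in> coord_space (A - I). extend A I (\<lambda>_. 0) x \<in> \<alpha>}"
    (is "local_arrangement _ ?\<beta>")
proof (rule local_arrangementI)
  fix x assume "x \<in> ?\<beta>"
  moreover obtain S where S: "S \<subseteq> signs A" "\<alpha> = (\<Union>s\<in>S. orthant A s)"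
    using assms(2) unfolding local_arrangement_def by blast
  ultimately obtain s where s: "s \<in> S" "extend A I (\<lambda>_. 0) x \<in> orthant A s"
      "x \<in> coord_space (A - I)" by auto
  have eq: "extend A I (\<lambda>_. 0) z \<in> orthant A s \<longleftrightarrow> z \<in> orthant (A - I) s"
    if "z \<in> coord_space (A - I)" for z
    using that extend_mem[of A I "\<lambda>_. 0" z] by (auto simp: orthant_def extend_def)
  have "s \<in> signs (A - I)" using s(1) S(1) by (auto simp: signs_def)
  moreover have "x \<in> orthant (A - I) s" using s eq by simp
  moreover have "orthant (A - I) s \<subseteq> ?\<beta>"
    using eq s(1) S(2) by (auto simp: orthant_def)
  ultimately show "\<exists>s\<in>signs (A - I). x \<in> orthant (A - I) s \<and> orthant (A - I) s \<subseteq> ?\<beta>" by blast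
qed

text \<open>A displacement inside the hyperplane vanishes on \<open>I\<close>; padded with zeros it
  stays in the cube, so the same radius works.\<close>

lemma is_tangent_cone_slice:
  assumes I: "I \<subseteq> A" and cone: "is_tangent_cone A P (extend A I l v) \<alpha>"
  shows "is_tangent_cone (A - I) (forget A I ` (P \<inter> gen_hyperplane A I l)) v
    {x \<in> coord_space (A - I). extend A I (\<lambda>_. 0) x \<in> \<alpha>}" (is "is_tangent_cone _ ?Q _ ?\<beta>")
proof -
  obtain d where a: "local_arrangement A \<alpha>" "d > 0"
      "\<forall>x\<in>cube A d. (\<lambda>i\<in>A. extend A I l v i + x i) \<in> P \<longleftrightarrow> x \<in> \<alpha>"
    using cone unfolding is_tangent_cone_iff by blast
  have "(\<lambda>i\<in>A - I. v i + x i) \<in> ?Q \<longleftrightarrow> x \<in> ?\<beta>" if x: "x \<in> cube (A - I) d" for x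
  proof -
    have "extend A I (\<lambda>_. 0) x \<in> cube A d"
      using x a(2) by (auto simp: cube_def extend_def PiE_iff)
    moreover have "(\<lambda>i\<in>A. extend A I l v i + extend A I (\<lambda>_. 0) x i) =
        extend A I l (\<lambda>i\<in>A - I. v i + x i)"
      by (auto simp: extend_def)
    ultimately have "extend A I l (\<lambda>i\<in>A - I. v i + x i) \<in> P \<longleftrightarrow> extend A I (\<lambda>_. 0) x \<in> \<alpha>"
      using a(3) by metis
    then show ?thesis
      unfolding mem_slice_iff[OF I]
      using x cube_subset[of "A - I" d] by (auto simp: coord_space_def)
  qed
  then show ?thesis
    unfolding is_tangent_cone_iff using local_arrangement_slice[OF I a(1)] a(2) by blast
qed

lemma read_once_slice:
  assumes "read_once A \<alpha>"
  shows "read_once (A - I) {x \<in> coord_space (A - I). extend A I (\<lambda>_. 0) x \<in> \<alpha>}"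
proof -
  obtain D s where D: "is_spd D" "edges D \<subseteq> A" "s \<in> signs A" "\<alpha> = spd_set A s D"
    using assms unfolding read_once_def by blast
  have "\<exists>f. spd_eval (\<lambda>i. if i \<in> I then True else f i) D"
    using spd_eval_True by (intro exI[of _ "\<lambda>_. True"]) simp
  then obtain D' where D': "is_spd D'" "edges D' \<subseteq> edges D - I"
    "\<And>f. spd_eval (\<lambda>e. if e \<in> I then True else f e) D = spd_eval f D'"
    using is_spd_freeze[OF D(1), of I "\<lambda>_. True"] by blast
  have "spd_eval (\<lambda>i. 0 \<le> s i * extend A I (\<lambda>_. 0) x i) D =
      spd_eval (\<lambda>i. if i \<in> I then True else 0 \<le> s i * x i) D" for x
    using D(2) by (intro spd_eval_cong) (auto simp: extend_def)
  then have "{x \<in> coord_space (A - I). extend A I (\<lambda>_. 0) x \<in> \<alpha>} = spd_set (A - I) s D'"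
    by (simp add: D(4) spd_set_eq_eval extend_mem D'(3))
  moreover have "s \<in> signs (A - I)" using D(3) by (auto simp: signs_def)
  ultimately show ?thesis unfolding read_once_def using D' D(2) by blast
qed

text \<open>Cones of the slice are slices of read-once cones, hence read-once. At a singular point
  every remaining coordinate is essential and therefore an edge, and a read-once cone using all
  coordinates is floral.\<close>

lemma generic_orthotope_slice:
  assumes fin: "finite A" and gen: "generic_orthotope A P" and I: "I \<subseteq> A"
  shows "generic_orthotope (A - I) (forget A I ` (P \<inter> gen_hyperplane A I l))"
    (is "generic_orthotope ?B ?Q")
proof -
  have P: "pure_orthogonal_polytope A P" using gen by (simp add: generic_orthotope_def)
  have Q: "pure_orthogonal_polytope ?B ?Q" using pure_orthogonal_polytope_slice[OF I P] .
  have "floral_vertex ?B (tangent_cone ?B ?Q v)" if v: "singular ?B ?Q v" for v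
  proof -
    define w where "w = extend A I l v"
    have "w \<in> P" using v unfolding singular_def mem_slice_iff[OF I] w_def by simp
    then have "read_once A (tangent_cone A P w)"
      by (rule generic_orthotope_tangent_cone[OF fin gen])
    moreover have "tangent_cone ?B ?Q v =
        {x \<in> coord_space ?B. extend A I (\<lambda>_. 0) x \<in> tangent_cone A P w}"
      unfolding w_def using fin
      by (intro tangent_cone_eq is_tangent_cone_slice[OF I] is_tangent_cone_tangent_cone[OF fin P])
        simp
    ultimately have "read_once ?B (tangent_cone ?B ?Q v)"
      using read_once_slice by metis
    then obtain D s where D: "is_spd D" "edges D \<subseteq> ?B" "s \<in> signs ?B"
        "tangent_cone ?B ?Q v = spd_set ?B s D"
      unfolding read_once_def by blast
    have "essential ?B (tangent_cone ?B ?Q v) = ?B"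
      using singular_imp_essential_all[OF _ Q v] fin by simp
    then have "edges D = ?B" using essential_spd_set[OF D(2), of s] D(2,4) by auto
    then show ?thesis unfolding floral_vertex_def using D by blast
  qed
  then show ?thesis using Q by (simp add: generic_orthotope_def)
qed

theorem proposition4p3:
  fixes d :: nat and P :: "(nat \<Rightarrow> real) set" and I :: "nat set" and l :: "nat \<Rightarrow> real"
  assumes "generic_orthotope {1..d} P"
    and "I \<subseteq> {1..d}"
  shows "generic_orthotope ({1..d} - I)
           (forget {1..d} I ` (P \<inter> gen_hyperplane {1..d} I l))"
  using assms by (intro generic_orthotope_slice) auto

end
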